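(* Let $k$ be a field containing a primitive $n$-th root of unity $q$, and let $C_n=\langle t\rangle$ be the cyclic group of order $n$. Let $x,y\in M_n(k)$ be the matrices determined on the standard basis $e_1,\dots,e_n$ of $k^n$ by $xe_i=e_{i+1}$ for $1\le i<n$, $xe_n=e_1$, and $ye_i=q^ie_i$ for $1\le i\le n$. Then the connected $C_n\times C_n$-grading of the matrix algebra $M_n(k)$ in which $x$ has degree $(t,1)$ and $y$ has degree $(1,t)$ is simply connected.
   Context: The algebra $M_n(k)$ has the presentation $k\{x,y\}/\langle x^n=1,\,y^n=1,\,yx=qxy\rangle$, so assigning degrees $(t,1)$ to $x$ and $(1,t)$ to $y$ defines a grading of $M_n(k)$. A $k$-category is a small category $\mathcal B$ whose morphism sets ${}_y\mathcal B_x$ (from $x$ to $y$) are $k$-vector spaces with $k$-bilinear composition; a $k$-algebra is viewed as a $k$-category with one object. A grading $X$ of $\mathcal B$ by a group $\Gamma$ is a decomposition ${}_y\mathcal B_x=\bigoplus_{s\in\Gamma}X^s({}_y\mathcal B_x)$ with $X^t({}_z\mathcal B_y)X^s({}_y\mathcal B_x)\subset X^{ts}({}_z\mathcal B_x)$. A non-zero walk is a finite composable sequence $(f_n,\epsilon_n)\cdots(f_1,\epsilon_1)$ of non-zero morphisms with signs $\epsilon_i=\pm1$ (sign $-1$ exchanges source and target); if all $f_i$ are homogeneous its degree is $(\deg f_n)^{\epsilon_n}\cdots(\deg f_1)^{\epsilon_1}$. $\mathcal B$ is connected if any two objects are joined by a non-zero walk; the grading is connected if any two objects can be joined by a non-zero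 homogeneous walk of any prescribed degree in $\Gamma$ (for an algebra this means that the support $\{s\in\Gamma: X^sA\ne0\}$ generates $\Gamma$). The smash product category $\mathcal B\#\Gamma$ has objects $\mathcal B_0\times\Gamma$; the morphisms from $(b,g)$ to $(c,h)$ are $X^{h^{-1}g}({}_c\mathcal B_b)$; composition is that of $\mathcal B$. A connected $k$-category is simply connected if its only connected grading is the trivial grading (i.e. the one by the trivial group). A connected grading of $\mathcal B$ by $\Gamma$ is simply connected if the corresponding Galois covering $\mathcal B\#\Gamma\to\mathcal B$ is simply connected, i.e. the $k$-category $\mathcal B\#\Gamma$ is simply connected. *)

theory Defs
  imports
    "Jordan_Normal_Form.VS_Connect"
    "HOL-Algebra.Elementary_Groups"
begin

definition primitive_root_of_unity :: "nat \<Rightarrow> 'k::field \<Rightarrow> bool" where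
  "primitive_root_of_unity n q \<longleftrightarrow>
     n > 0 \<and> q ^ n = 1 \<and> (\<forall>m. 0 < m \<and> m < n \<longrightarrow> q ^ m \<noteq> 1)"

section \<open>Linear categories\<close>

text \<open>
  \<open>Hom B b c\<close> is the space of morphisms from \<open>b\<close> to \<open>c\<close>, and \<open>Comp B b c d g f\<close> is the
  composite of \<open>f\<close> from \<open>b\<close> to \<open>c\<close> followed by \<open>g\<close> from \<open>c\<close> to \<open>d\<close>. Hom spaces for different
  pairs of objects may share elements of the type \<open>'m\<close>, so a morphism is always taken
  together with its source and target. A vector space is a HOL-Algebra \<open>module\<close> record;
  its ring fields \<open>mult\<close> and \<open>one\<close> play no role in \<open>Hom B b c\<close>.
\<close>

record ('o, 'k, 'm) kcat =
  Obj :: "'o set"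
  Hom :: "'o \<Rightarrow> 'o \<Rightarrow> ('k, 'm) module"
  Comp :: "'o \<Rightarrow> 'o \<Rightarrow> 'o \<Rightarrow> 'm \<Rightarrow> 'm \<Rightarrow> 'm"
  Ident :: "'o \<Rightarrow> 'm"

locale k_category = field K for K :: "'k ring" (structure) +
  fixes B :: "('o, 'k, 'm) kcat"
  assumes Hom_vectorspace:
      "\<lbrakk>b \<in> Obj B; c \<in> Obj B\<rbrakk> \<Longrightarrow> vectorspace K (Hom B b c)"
    and Comp_closed:
      "\<lbrakk>b \<in> Obj B; c \<in> Obj B; d \<in> Obj B; f \<in> carrier (Hom B b c); g \<in> carrier (Hom B c d)\<rbrakk>
        \<Longrightarrow> Comp B b c d g f \<in> carrier (Hom B b d)"
    and Comp_add_left: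
      "\<lbrakk>b \<in> Obj B; c \<in> Obj B; d \<in> Obj B; f \<in> carrier (Hom B b c);
        g \<in> carrier (Hom B c d); g' \<in> carrier (Hom B c d)\<rbrakk>
        \<Longrightarrow> Comp B b c d (g \<oplus>\<^bsub>Hom B c d\<^esub> g') f =
            Comp B b c d g f \<oplus>\<^bsub>Hom B b d\<^esub> Comp B b c d g' f"
    and Comp_add_right:
      "\<lbrakk>b \<in> Obj B; c \<in> Obj B; d \<in> Obj B; f \<in> carrier (Hom B b c);
        f' \<in> carrier (Hom B b c); g \<in> carrier (Hom B c d)\<rbrakk>
        \<Longrightarrow> Comp B b c d g (f \<oplus>\<^bsub>Hom B b c\<^esub> f') =
            Comp B b c d g f \<oplus>\<^bsub>Hom B b d\<^esub> Comp B b c d g f'"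
    and Comp_smult_left:
      "\<lbrakk>b \<in> Obj B; c \<in> Obj B; d \<in> Obj B; a \<in> carrier K; f \<in> carrier (Hom B b c);
        g \<in> carrier (Hom B c d)\<rbrakk>
        \<Longrightarrow> Comp B b c d (a \<odot>\<^bsub>Hom B c d\<^esub> g) f = a \<odot>\<^bsub>Hom B b d\<^esub> Comp B b c d g f"
    and Comp_smult_right:
      "\<lbrakk>b \<in> Obj B; c \<in> Obj B; d \<in> Obj B; a \<in> carrier K; f \<in> carrier (Hom B b c);
        g \<in> carrier (Hom B c d)\<rbrakk>
        \<Longrightarrow> Comp B b c d g (a \<odot>\<^bsub>Hom B b c\<^esub> f) = a \<odot>\<^bsub>Hom B b d\<^esub> Comp B b c d g f"
    and Comp_assoc:
      "\<lbrakk>b \<in> Obj B; c \<in> Obj B; d \<in> Obj B; e \<in> Obj B; f \<in> carrier (Hom B b c);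
        g \<in> carrier (Hom B c d); h \<in> carrier (Hom B d e)\<rbrakk>
        \<Longrightarrow> Comp B b c e (Comp B c d e h g) f = Comp B b d e h (Comp B b c d g f)"
    and Ident_closed: "b \<in> Obj B \<Longrightarrow> Ident B b \<in> carrier (Hom B b b)"
    and Ident_left:
      "\<lbrakk>b \<in> Obj B; c \<in> Obj B; f \<in> carrier (Hom B b c)\<rbrakk> \<Longrightarrow> Comp B b c c (Ident B c) f = f"
    and Ident_right:
      "\<lbrakk>b \<in> Obj B; c \<in> Obj B; f \<in> carrier (Hom B b c)\<rbrakk> \<Longrightarrow> Comp B b b c f (Ident B b) = f"

text \<open>
  The algebra structure comes from the fields \<open>mult\<close> and \<open>one\<close> of the module record.
  (The locale \<open>algebra\<close> of HOL-Algebra is not used because it is restricted to commutative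
  algebras.)
\<close>

definition one_object_kcat :: "('k, 'm) module \<Rightarrow> (unit, 'k, 'm) kcat" where
  "one_object_kcat A =
     \<lparr>Obj = {()}, Hom = (\<lambda>_ _. A), Comp = (\<lambda>_ _ _ g f. g \<otimes>\<^bsub>A\<^esub> f), Ident = (\<lambda>_. \<one>\<^bsub>A\<^esub>)\<rparr>"

section \<open>Walks\<close>

text \<open>
  A step \<open>(b, c, f, \<epsilon>)\<close> is the signed morphism \<open>(f, \<epsilon>)\<close> with \<open>f\<close> from \<open>b\<close> to \<open>c\<close>. The walk
  \<open>(f\<^sub>n, \<epsilon>\<^sub>n) \<dots> (f\<^sub>1, \<epsilon>\<^sub>1)\<close> is the list whose head is step \<open>n\<close> and whose last element is
  step \<open>1\<close>.
\<close>

type_synonym ('o, 'm) walk_step = "'o \<times> 'o \<times> 'm \<times> int"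

fun step_source :: "('o, 'm) walk_step \<Rightarrow> 'o" where
  "step_source (b, c, f, \<epsilon>) = (if \<epsilon> = 1 then b else c)"

fun step_target :: "('o, 'm) walk_step \<Rightarrow> 'o" where
  "step_target (b, c, f, \<epsilon>) = (if \<epsilon> = 1 then c else b)"

definition nonzero_walk ::
  "('o, 'k, 'm) kcat \<Rightarrow> 'o \<Rightarrow> 'o \<Rightarrow> ('o, 'm) walk_step list \<Rightarrow> bool" where
  "nonzero_walk B u v ws \<longleftrightarrow>
     ws \<noteq> [] \<and>
     (\<forall>(b, c, f, \<epsilon>) \<in> set ws. b \<in> Obj B \<and> c \<in> Obj B \<and>
        f \<in> carrier (Hom B b c) \<and> f \<noteq> \<zero>\<^bsub>Hom B b c\<^esub> \<and> (\<epsilon> = 1 \<or> \<epsilon> = -1)) \<and>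
     successively (\<lambda>w w'. step_source w = step_target w') ws \<and>
     step_source (last ws) = u \<and> step_target (hd ws) = v"

definition connected_kcat :: "('o, 'k, 'm) kcat \<Rightarrow> bool" where
  "connected_kcat B \<longleftrightarrow> (\<forall>u\<in>Obj B. \<forall>v\<in>Obj B. \<exists>ws. nonzero_walk B u v ws)"

section \<open>Gradings\<close>

definition direct_sum_decomposition ::
  "'k ring \<Rightarrow> ('k, 'm) module \<Rightarrow> 's set \<Rightarrow> ('s \<Rightarrow> 'm set) \<Rightarrow> bool" where
  "direct_sum_decomposition K V S W \<longleftrightarrow>
     (\<forall>s\<in>S. subspace K (W s) V) \<and>
     (\<forall>v\<in>carrier V. \<exists>!\<phi>. \<phi> \<in> (\<Pi>\<^sub>E s\<in>S. W s) \<and> finite {s\<in>S. \<phi> s \<noteq> \<zero>\<^bsub>V\<^esub>} \<and>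
        v = (\<Oplus>\<^bsub>V\<^esub>s\<in>{s\<in>S. \<phi> s \<noteq> \<zero>\<^bsub>V\<^esub>}. \<phi> s))"

text \<open>\<open>X s b c\<close> is the component of degree \<open>s\<close> of \<open>Hom B b c\<close>.\<close>

locale grading = k_category K B + \<Gamma>: group \<Gamma>
  for K :: "'k ring" and B :: "('o, 'k, 'm) kcat" and \<Gamma> :: "'g monoid" +
  fixes X :: "'g \<Rightarrow> 'o \<Rightarrow> 'o \<Rightarrow> 'm set"
  assumes decomposition:
      "\<lbrakk>b \<in> Obj B; c \<in> Obj B\<rbrakk>
        \<Longrightarrow> direct_sum_decomposition K (Hom B b c) (carrier \<Gamma>) (\<lambda>s. X s b c)"
    and graded_Comp:
      "\<lbrakk>b \<in> Obj B; c \<in> Obj B; d \<in> Obj B; s \<in> carrier \<Gamma>; r \<in> carrier \<Gamma>;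
        f \<in> X s b c; g \<in> X r c d\<rbrakk> \<Longrightarrow> Comp B b c d g f \<in> X (r \<otimes>\<^bsub>\<Gamma>\<^esub> s) b d"

definition homogeneous_walk ::
  "'g monoid \<Rightarrow> ('g \<Rightarrow> 'o \<Rightarrow> 'o \<Rightarrow> 'm set) \<Rightarrow> ('o, 'm) walk_step list \<Rightarrow> bool" where
  "homogeneous_walk \<Gamma> X ws \<longleftrightarrow> (\<forall>(b, c, f, \<epsilon>) \<in> set ws. \<exists>s\<in>carrier \<Gamma>. f \<in> X s b c)"

text \<open>Meaningful for non-zero homogeneous \<open>f\<close>, whose degree is unique.\<close>

definition mor_degree ::
  "'g monoid \<Rightarrow> ('g \<Rightarrow> 'o \<Rightarrow> 'o \<Rightarrow> 'm set) \<Rightarrow> 'o \<Rightarrow> 'o \<Rightarrow> 'm \<Rightarrow> 'g" where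
  "mor_degree \<Gamma> X b c f = (THE s. s \<in> carrier \<Gamma> \<and> f \<in> X s b c)"

fun walk_degree ::
  "'g monoid \<Rightarrow> ('g \<Rightarrow> 'o \<Rightarrow> 'o \<Rightarrow> 'm set) \<Rightarrow> ('o, 'm) walk_step list \<Rightarrow> 'g" where
  "walk_degree \<Gamma> X [] = \<one>\<^bsub>\<Gamma>\<^esub>"
| "walk_degree \<Gamma> X ((b, c, f, \<epsilon>) # ws) =
     (mor_degree \<Gamma> X b c f [^]\<^bsub>\<Gamma>\<^esub> \<epsilon>) \<otimes>\<^bsub>\<Gamma>\<^esub> walk_degree \<Gamma> X ws"

definition connected_grading ::
  "'k ring \<Rightarrow> ('o, 'k, 'm) kcat \<Rightarrow> 'g monoid \<Rightarrow> ('g \<Rightarrow> 'o \<Rightarrow> 'o \<Rightarrow> 'm set) \<Rightarrow> bool" where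
  "connected_grading K B \<Gamma> X \<longleftrightarrow>
     grading K B \<Gamma> X \<and>
     (\<forall>u\<in>Obj B. \<forall>v\<in>Obj B. \<forall>s\<in>carrier \<Gamma>.
        \<exists>ws. nonzero_walk B u v ws \<and> homogeneous_walk \<Gamma> X ws \<and> walk_degree \<Gamma> X ws = s)"

section \<open>Simple connectedness\<close>

definition smash_product ::
  "('o, 'k, 'm) kcat \<Rightarrow> 'g monoid \<Rightarrow> ('g \<Rightarrow> 'o \<Rightarrow> 'o \<Rightarrow> 'm set) \<Rightarrow> ('o \<times> 'g, 'k, 'm) kcat" where
  "smash_product B \<Gamma> X =
     \<lparr>Obj = Obj B \<times> carrier \<Gamma>,
      Hom = (\<lambda>(b, g) (c, h). (Hom B b c)\<lparr>carrier := X (inv\<^bsub>\<Gamma>\<^esub> h \<otimes>\<^bsub>\<Gamma>\<^esub> g) b c\<rparr>),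
      Comp = (\<lambda>(b, _) (c, _) (d, _). Comp B b c d),
      Ident = (\<lambda>(b, _). Ident B b)\<rparr>"

text \<open>
  The quantification over grading groups cannot range over all types inside a definition:
  the argument \<open>TYPE('g)\<close> fixes the type of their elements. In a conclusion, leaving \<open>'g\<close>
  a free type variable gives the statement for groups over every type. The grading by a
  trivial group is unique, so a grading is the trivial one iff its group is trivial.
\<close>

definition simply_connected_kcat ::
  "'g itself \<Rightarrow> 'k ring \<Rightarrow> ('o, 'k, 'm) kcat \<Rightarrow> bool" where
  "simply_connected_kcat _ K B \<longleftrightarrow>
     k_category K B \<and> connected_kcat B \<and>
     (\<forall>(\<Gamma> :: 'g monoid) X. connected_grading K B \<Gamma> X \<longrightarrow> trivial_group \<Gamma>)"

definition simply_connected_grading ::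
  "'g itself \<Rightarrow> 'k ring \<Rightarrow> ('o, 'k, 'm) kcat \<Rightarrow> 'h monoid \<Rightarrow>
    ('h \<Rightarrow> 'o \<Rightarrow> 'o \<Rightarrow> 'm set) \<Rightarrow> bool" where
  "simply_connected_grading ty K B \<Gamma> X \<longleftrightarrow>
     connected_grading K B \<Gamma> X \<and> simply_connected_kcat ty K (smash_product B \<Gamma> X)"

section \<open>Shift and clock matrices\<close>

text \<open>Vectors are indexed from \<open>0\<close>, while the standard basis is numbered from \<open>1\<close> to \<open>n\<close>.\<close>

abbreviation std_basis :: "nat \<Rightarrow> nat \<Rightarrow> 'k::field vec" where
  "std_basis n i \<equiv> unit_vec n (i - 1)"

definition shift_matrix :: "nat \<Rightarrow> 'k::field mat \<Rightarrow> bool" where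
  "shift_matrix n x \<longleftrightarrow> x \<in> carrier_mat n n \<and>
     (\<forall>i. 1 \<le> i \<and> i < n \<longrightarrow> x *\<^sub>v std_basis n i = std_basis n (i + 1)) \<and>
     x *\<^sub>v std_basis n n = std_basis n 1"

definition clock_matrix :: "nat \<Rightarrow> 'k::field \<Rightarrow> 'k mat \<Rightarrow> bool" where
  "clock_matrix n q y \<longleftrightarrow> y \<in> carrier_mat n n \<and>
     (\<forall>i. 1 \<le> i \<and> i \<le> n \<longrightarrow> y *\<^sub>v std_basis n i = q ^ i \<cdot>\<^sub>v std_basis n i)"

end

theory Submission
  imports "HOL-Algebra.Multiplicative_Group" "HOL-Number_Theory.Cong"
    "HOL-Computational_Algebra.Polynomial" Defs
begin

text \<open>
  Every non-zero homogeneous matrix is a scalar multiple of a monomial \<open>x\<^sup>i y\<^sup>j\<close>. Indeed the \<open>n\<^sup>2\<close>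
  monomials with \<open>i, j < n\<close> form a basis of \<open>M\<^sub>n(k)\<close> (by Fourier inversion along the cyclic
  diagonals, \<open>clock_shift_expansion\<close>), and they have pairwise distinct degrees \<open>(t\<^sup>i, t\<^sup>j)\<close>. So
  the grading has one-dimensional components, and it is the only one in which \<open>x\<close> and \<open>y\<close> have
  the given degrees, because such a grading must contain each of these lines in the component
  of its degree and two decompositions with one inside the other coincide.

  Consequently all morphism spaces of the smash product are one-dimensional. As the monomials
  are invertible, a composite of non-zero morphisms is never zero. These two properties exclude
  every non-trivial connected grading of a non-empty category (\<open>connected_grading_trivial\<close>): a line
  can only be graded by being homogeneous as a whole, so each pair of objects \<open>b, c\<close> has a
  single degree \<open>D b c\<close>, and non-vanishing of composites gives \<open>D c d \<otimes> D b c = D b d\<close>. The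
  degree of a walk then depends on its endpoints only, and closed walks have degree \<open>\<one>\<close>; if
  closed walks realise every degree, the grading group is trivial.
\<close>

section \<open>Direct sum decompositions\<close>

lemma subspace_mem:
  assumes "subspace K W V"
  shows "W \<subseteq> carrier V" "\<zero>\<^bsub>V\<^esub> \<in> W"
    "\<lbrakk>a \<in> carrier K; v \<in> W\<rbrakk> \<Longrightarrow> a \<odot>\<^bsub>V\<^esub> v \<in> W"
proof -
  interpret LinearCombinations.submodule K W V by (rule subspace.submod[OF assms])
  show "W \<subseteq> carrier V" "\<zero>\<^bsub>V\<^esub> \<in> W" "\<lbrakk>a \<in> carrier K; v \<in> W\<rbrakk> \<Longrightarrow> a \<odot>\<^bsub>V\<^esub> v \<in> W"
    by (rule subset, rule zero_closed, rule smult_closed)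
qed

lemma decomposition_subspace:
  "\<lbrakk>direct_sum_decomposition K V S W; s \<in> S\<rbrakk> \<Longrightarrow> subspace K (W s) V"
  unfolding direct_sum_decomposition_def by blast

lemma decomposition_exists:
  assumes "direct_sum_decomposition K V S W" "v \<in> carrier V"
  obtains \<phi> where "\<phi> \<in> (\<Pi>\<^sub>E s\<in>S. W s)" "finite {s\<in>S. \<phi> s \<noteq> \<zero>\<^bsub>V\<^esub>}"
    "v = (\<Oplus>\<^bsub>V\<^esub>s\<in>{s\<in>S. \<phi> s \<noteq> \<zero>\<^bsub>V\<^esub>}. \<phi> s)"
  using assms unfolding direct_sum_decomposition_def by (elim conjE ballE ex1E) blast+

lemma decomposition_unique:
  assumes "direct_sum_decomposition K V S W" "v \<in> carrier V"
    and "\<phi> \<in> (\<Pi>\<^sub>E s\<in>S. W s)" "finite {s\<in>S. \<phi> s \<noteq> \<zero>\<^bsub>V\<^esub>}"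
      "v = (\<Oplus>\<^bsub>V\<^esub>s\<in>{s\<in>S. \<phi> s \<noteq> \<zero>\<^bsub>V\<^esub>}. \<phi> s)"
    and "\<psi> \<in> (\<Pi>\<^sub>E s\<in>S. W s)" "finite {s\<in>S. \<psi> s \<noteq> \<zero>\<^bsub>V\<^esub>}"
      "v = (\<Oplus>\<^bsub>V\<^esub>s\<in>{s\<in>S. \<psi> s \<noteq> \<zero>\<^bsub>V\<^esub>}. \<psi> s)"
  shows "\<phi> = \<psi>"
proof -
  let ?P = "\<lambda>\<phi>. \<phi> \<in> (\<Pi>\<^sub>E s\<in>S. W s) \<and> finite {s\<in>S. \<phi> s \<noteq> \<zero>\<^bsub>V\<^esub>} \<and>
      v = (\<Oplus>\<^bsub>V\<^esub>s\<in>{s\<in>S. \<phi> s \<noteq> \<zero>\<^bsub>V\<^esub>}. \<phi> s)"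
  have ex1: "\<exists>!\<phi>. ?P \<phi>" using assms(1,2) unfolding direct_sum_decomposition_def by blast
  have "(THE \<phi>. ?P \<phi>) = \<phi>" by (rule the1_equality[OF ex1]) (intro conjI assms)
  moreover have "(THE \<phi>. ?P \<phi>) = \<psi>" by (rule the1_equality[OF ex1]) (intro conjI assms)
  ultimately show ?thesis by (rule trans[OF sym])
qed

text \<open>
  The family supported at the single index \<open>s\<close> is the decomposition of an element of \<open>W s\<close>.
  Comparing it with other decompositions of the same element is how uniqueness is exploited below.
\<close>
lemma decomposition_of_component:
  fixes V (structure)
  assumes V: "vectorspace K V" and W: "\<And>r. r \<in> S \<Longrightarrow> subspace K (W r) V"
    and s: "s \<in> S" and v: "v \<in> W s"
  defines "\<phi> \<equiv> (\<lambda>r\<in>S. if r = s then v else \<zero>)"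
  shows "\<phi> \<in> (\<Pi>\<^sub>E s\<in>S. W s)" "finite {r\<in>S. \<phi> r \<noteq> \<zero>}"
    "v = (\<Oplus>r\<in>{r\<in>S. \<phi> r \<noteq> \<zero>}. \<phi> r)"
proof -
  interpret vectorspace K V by fact
  have vV: "v \<in> carrier V" using subspace_mem(1)[OF W[OF s]] v by blast
  show "\<phi> \<in> (\<Pi>\<^sub>E s\<in>S. W s)"
    using v subspace_mem(2)[OF W] by (auto simp: \<phi>_def)
  have supp: "{r\<in>S. \<phi> r \<noteq> \<zero>} = (if v = \<zero> then {} else {s})"
    using s by (auto simp: \<phi>_def)
  show "finite {r\<in>S. \<phi> r \<noteq> \<zero>}" unfolding supp by simp
  have "(\<Oplus>r\<in>{s}. \<phi> r) = v"
    using M.finsum_insert[of "{}" s \<phi>] s vV by (simp add: \<phi>_def)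
  then show "v = (\<Oplus>r\<in>{r\<in>S. \<phi> r \<noteq> \<zero>}. \<phi> r)"
    unfolding supp by auto
qed

lemma degree_unique:
  assumes V: "vectorspace K V" and D: "direct_sum_decomposition K V S W"
    and s: "s \<in> S" "v \<in> W s" and r: "r \<in> S" "v \<in> W r" and v: "v \<noteq> \<zero>\<^bsub>V\<^esub>"
  shows "s = r"
proof -
  note W = decomposition_subspace[OF D]
  have "v \<in> carrier V" using subspace_mem(1)[OF W[OF s(1)]] s by blast
  from decomposition_unique[OF D this decomposition_of_component[where W = W, OF V W s]
      decomposition_of_component[where W = W, OF V W r]]
  have "(\<lambda>u\<in>S. if u = s then v else \<zero>\<^bsub>V\<^esub>) s = (\<lambda>u\<in>S. if u = r then v else \<zero>\<^bsub>V\<^esub>) s"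
    by (rule fun_cong)
  then show "s = r" using s(1) v by (auto split: if_splits)
qed

text \<open>
  A decomposition along the smaller family is also one along the larger family, so for an element
  of \<open>W' s\<close> it must be the family supported at \<open>s\<close>; its entry at \<open>s\<close> lies in \<open>W s\<close>.
\<close>
lemma decomposition_eqI:
  assumes V: "vectorspace K V"
    and D: "direct_sum_decomposition K V S W" and D': "direct_sum_decomposition K V S W'"
    and sub: "\<And>s. s \<in> S \<Longrightarrow> W s \<subseteq> W' s" and s: "s \<in> S"
  shows "W' s = W s"
proof
  show "W' s \<subseteq> W s"
  proof
    fix v assume v: "v \<in> W' s"
    note W' = decomposition_subspace[OF D']
    have vV: "v \<in> carrier V" using subspace_mem(1)[OF W'[OF s]] v by blast
    obtain \<phi> where \<phi>: "\<phi> \<in> (\<Pi>\<^sub>E s\<in>S. W s)" "finite {s\<in>S. \<phi> s \<noteq> \<zero>\<^bsub>V\<^esub>}"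
      "v = (\<Oplus>\<^bsub>V\<^esub>s\<in>{s\<in>S. \<phi> s \<noteq> \<zero>\<^bsub>V\<^esub>}. \<phi> s)"
      by (rule decomposition_exists[OF D vV])
    have "\<phi> \<in> (\<Pi>\<^sub>E s\<in>S. W' s)" using \<phi>(1) sub by (auto simp: PiE_iff)
    from decomposition_unique[OF D' vV this \<phi>(2,3)
        decomposition_of_component[where W = W', OF V W' s v]]
    have "\<phi> s = v" using s by simp
    then show "v \<in> W s" using \<phi>(1) s by auto
  qed
qed (rule sub[OF s])

text \<open>
  Some entry of the decomposition of a generator \<open>e\<close> is non-zero, and on a line a non-zero vector
  is again a generator.
\<close>
lemma decomposition_of_line:
  assumes V: "vectorspace K V" and D: "direct_sum_decomposition K V S W"
    and e: "e \<in> carrier V" "e \<noteq> \<zero>\<^bsub>V\<^esub>"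
    and line: "\<And>v. v \<in> carrier V \<Longrightarrow> \<exists>a\<in>carrier K. v = a \<odot>\<^bsub>V\<^esub> e"
  shows "\<exists>s\<in>S. carrier V \<subseteq> W s"
proof -
  interpret vectorspace K V by fact
  obtain \<phi> where \<phi>: "\<phi> \<in> (\<Pi>\<^sub>E s\<in>S. W s)"
    "e = (\<Oplus>\<^bsub>V\<^esub>s\<in>{s\<in>S. \<phi> s \<noteq> \<zero>\<^bsub>V\<^esub>}. \<phi> s)"
    by (rule decomposition_exists[OF D e(1)])
  have "{s\<in>S. \<phi> s \<noteq> \<zero>\<^bsub>V\<^esub>} \<noteq> {}"
  proof
    assume "{s\<in>S. \<phi> s \<noteq> \<zero>\<^bsub>V\<^esub>} = {}"
    with \<phi>(2) have "e = \<zero>\<^bsub>V\<^esub>" by (simp only: M.finsum_empty)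
    with e(2) show False ..
  qed
  then obtain s where s: "s \<in> S" "\<phi> s \<noteq> \<zero>\<^bsub>V\<^esub>" by blast
  note W = decomposition_subspace[OF D s(1)]
  have \<phi>s: "\<phi> s \<in> W s" using \<phi>(1) s by auto
  then have "\<phi> s \<in> carrier V" using subspace_mem(1)[OF W] by blast
  then obtain a where a: "a \<in> carrier K" "\<phi> s = a \<odot>\<^bsub>V\<^esub> e" using line by blast
  then have "a \<noteq> \<zero>\<^bsub>K\<^esub>" using s(2) e(1) by auto
  then have inv: "inv\<^bsub>K\<^esub> a \<in> carrier K" "inv\<^bsub>K\<^esub> a \<otimes>\<^bsub>K\<^esub> a = \<one>\<^bsub>K\<^esub>"
    using a(1) by (auto simp: field_Units)
  have "e = inv\<^bsub>K\<^esub> a \<odot>\<^bsub>V\<^esub> \<phi> s"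
    using a e(1) inv by (simp add: smult_assoc1[symmetric])
  then have "e \<in> W s" using subspace_mem(3)[OF W inv(1) \<phi>s] by simp
  then have "carrier V \<subseteq> W s" using line subspace_mem(3)[OF W] by blast
  then show ?thesis using s(1) by blast
qed

text \<open>
  A complete orthogonal family of additive projections determines a decomposition: applying \<open>p s\<close>
  to a sum of components recovers the entry at \<open>s\<close>, which gives uniqueness.
\<close>
lemma decomposition_of_projections:
  fixes V (structure)
  assumes V: "vectorspace K V" and S: "finite S" and W: "\<And>s. s \<in> S \<Longrightarrow> subspace K (W s) V"
    and p_in: "\<And>s v. \<lbrakk>s \<in> S; v \<in> carrier V\<rbrakk> \<Longrightarrow> p s v \<in> W s"
    and p_add: "\<And>s v w. \<lbrakk>s \<in> S; v \<in> carrier V; w \<in> carrier V\<rbrakk> \<Longrightarrow> p s (v \<oplus> w) = p s v \<oplus> p s w"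
    and p_id: "\<And>s v. \<lbrakk>s \<in> S; v \<in> W s\<rbrakk> \<Longrightarrow> p s v = v"
    and p_0: "\<And>s r v. \<lbrakk>s \<in> S; r \<in> S; s \<noteq> r; v \<in> W r\<rbrakk> \<Longrightarrow> p s v = \<zero>"
    and p_sum: "\<And>v. v \<in> carrier V \<Longrightarrow> v = (\<Oplus>s\<in>S. p s v)"
  shows "direct_sum_decomposition K V S W"
  unfolding direct_sum_decomposition_def
proof (intro conjI ballI)
  interpret vectorspace K V by fact
  note W_carrier = subspace_mem(1)[OF W]
  have p_V: "p s v \<in> carrier V" if "s \<in> S" "v \<in> carrier V" for s v
    using p_in[OF that] W_carrier[OF that(1)] by blast
  have support: "(\<Oplus>s\<in>{s\<in>S. \<phi> s \<noteq> \<zero>}. \<phi> s) = (\<Oplus>s\<in>S. \<phi> s)"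
    if "\<phi> \<in> (\<Pi>\<^sub>E s\<in>S. W s)" for \<phi>
    using that W_carrier S
    by (intro M.add.finprod_mono_neutral_cong_left[folded finsum_def]) (auto simp: PiE_iff Pi_iff)
  fix v assume v: "v \<in> carrier V"
  let ?P = "\<lambda>\<phi>. \<phi> \<in> (\<Pi>\<^sub>E s\<in>S. W s) \<and> finite {s\<in>S. \<phi> s \<noteq> \<zero>} \<and>
      v = (\<Oplus>s\<in>{s\<in>S. \<phi> s \<noteq> \<zero>}. \<phi> s)"
  show "\<exists>!\<phi>. ?P \<phi>"
  proof (rule ex1I)
    have mem: "(\<lambda>s\<in>S. p s v) \<in> (\<Pi>\<^sub>E s\<in>S. W s)" using p_in v by auto
    have "v = (\<Oplus>s\<in>S. p s v)" by (rule p_sum[OF v])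
    also have "\<dots> = (\<Oplus>s\<in>S. (\<lambda>s\<in>S. p s v) s)"
      using p_V[OF _ v] by (intro M.finsum_cong') auto
    finally show "?P (\<lambda>s\<in>S. p s v)"
      unfolding support[OF mem] by (intro conjI mem) (use S in simp)
  next
    fix \<phi> assume \<phi>: "?P \<phi>"
    then have mem: "\<phi> \<in> (\<Pi>\<^sub>E s\<in>S. W s)" by blast
    then have in_W: "\<phi> r \<in> W r" if "r \<in> S" for r using that by auto
    have in_V: "\<phi> r \<in> carrier V" if "r \<in> S" for r using in_W W_carrier that by blast
    have v_eq: "v = (\<Oplus>r\<in>S. \<phi> r)" using \<phi> support[OF mem] by simp
    have "p s v = \<phi> s" if s: "s \<in> S" for s
    proof -
      have "p s (\<Oplus>r\<in>T. \<phi> r) = (if s \<in> T then \<phi> s else \<zero>)" if "T \<subseteq> S" for T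
        using finite_subset[OF that S] that
      proof (induction T rule: finite_induct)
        case empty
        then show ?case using p_id[OF s subspace_mem(2)[OF W[OF s]]] by simp
      next
        case (insert r T)
        then have "(\<Oplus>r\<in>insert r T. \<phi> r) = \<phi> r \<oplus> (\<Oplus>r\<in>T. \<phi> r)"
          using in_V by (intro M.finsum_insert) auto
        moreover have "(\<Oplus>r\<in>T. \<phi> r) \<in> carrier V"
          using insert.prems in_V by (intro M.finsum_closed) auto
        ultimately have "p s (\<Oplus>r\<in>insert r T. \<phi> r) = p s (\<phi> r) \<oplus> (if s \<in> T then \<phi> s else \<zero>)"
          using insert p_add[OF s] in_V by simp
        then show ?case
          using insert s p_id[OF s in_W[OF s]] p_0[OF s _ _ in_W, of r] in_V by (cases "r = s") auto
      qed
      from this[of S] show ?thesis using s v_eq by simp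
    qed
    then show "\<phi> = (\<lambda>s\<in>S. p s v)"
      using mem by (intro ext) (auto simp: PiE_iff extensional_def)
  qed
qed (rule W)

section \<open>Gradings of categories with one-dimensional morphism spaces\<close>

lemma (in grading) degree_eq:
  assumes "b \<in> Obj B" "c \<in> Obj B" "s \<in> carrier \<Gamma>" "f \<in> X s b c" "f \<noteq> \<zero>\<^bsub>Hom B b c\<^esub>"
  shows "mor_degree \<Gamma> X b c f = s"
  unfolding mor_degree_def
  using assms degree_unique[OF Hom_vectorspace decomposition] by (intro the_equality) blast+

text \<open>
  The heart of the argument. Each morphism space lies in one degree \<open>D b c\<close>, and \<open>D\<close> is
  multiplicative along composable pairs because no composite of non-zero morphisms vanishes. Hence
  a walk from \<open>u\<close> to \<open>v\<close>, also one that traverses morphisms backwards, has degree \<open>D u v\<close>.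
\<close>
lemma connected_grading_trivial:
  assumes connected: "connected_grading K B \<Gamma> X" and nonempty: "Obj B \<noteq> {}"
    and line: "\<And>b c. \<lbrakk>b \<in> Obj B; c \<in> Obj B\<rbrakk> \<Longrightarrow> \<exists>e\<in>carrier (Hom B b c). e \<noteq> \<zero>\<^bsub>Hom B b c\<^esub> \<and>
        (\<forall>f\<in>carrier (Hom B b c). \<exists>a\<in>carrier K. f = a \<odot>\<^bsub>Hom B b c\<^esub> e)"
    and nonzero: "\<And>b c d f g. \<lbrakk>b \<in> Obj B; c \<in> Obj B; d \<in> Obj B;
        f \<in> carrier (Hom B b c); f \<noteq> \<zero>\<^bsub>Hom B b c\<^esub>; g \<in> carrier (Hom B c d); g \<noteq> \<zero>\<^bsub>Hom B c d\<^esub>\<rbrakk>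
        \<Longrightarrow> Comp B b c d g f \<noteq> \<zero>\<^bsub>Hom B b d\<^esub>"
  shows "trivial_group \<Gamma>"
proof -
  interpret grading K B \<Gamma> X using connected unfolding connected_grading_def by blast
  have "\<exists>s\<in>carrier \<Gamma>. carrier (Hom B b c) \<subseteq> X s b c" if "b \<in> Obj B" "c \<in> Obj B" for b c
    using line[OF that] decomposition_of_line[OF Hom_vectorspace[OF that] decomposition[OF that]]
    by meson
  then obtain D where D: "\<And>b c. \<lbrakk>b \<in> Obj B; c \<in> Obj B\<rbrakk> \<Longrightarrow> D b c \<in> carrier \<Gamma>"
    "\<And>b c. \<lbrakk>b \<in> Obj B; c \<in> Obj B\<rbrakk> \<Longrightarrow> carrier (Hom B b c) \<subseteq> X (D b c) b c"
    by metis
  have in_X: "f \<in> X (D b c) b c"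
    if "b \<in> Obj B" "c \<in> Obj B" "f \<in> carrier (Hom B b c)" for b c f
    using that D(2) by blast
  have degree: "mor_degree \<Gamma> X b c f = D b c"
    if "b \<in> Obj B" "c \<in> Obj B" "f \<in> carrier (Hom B b c)" "f \<noteq> \<zero>\<^bsub>Hom B b c\<^esub>" for b c f
    using that D(1) in_X by (intro degree_eq) auto
  have cocycle: "D c d \<otimes>\<^bsub>\<Gamma>\<^esub> D b c = D b d"
    if bcd: "b \<in> Obj B" "c \<in> Obj B" "d \<in> Obj B" for b c d
  proof -
    obtain f where f: "f \<in> carrier (Hom B b c)" "f \<noteq> \<zero>\<^bsub>Hom B b c\<^esub>" using line bcd by blast
    obtain g where g: "g \<in> carrier (Hom B c d)" "g \<noteq> \<zero>\<^bsub>Hom B c d\<^esub>" using line bcd by blast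
    have "Comp B b c d g f \<in> X (D c d \<otimes>\<^bsub>\<Gamma>\<^esub> D b c) b d"
      using bcd f g D(1) in_X by (intro graded_Comp) auto
    then have "mor_degree \<Gamma> X b d (Comp B b c d g f) = D c d \<otimes>\<^bsub>\<Gamma>\<^esub> D b c"
      using bcd f g D(1) nonzero by (intro degree_eq) auto
    moreover have "mor_degree \<Gamma> X b d (Comp B b c d g f) = D b d"
      using bcd f g nonzero Comp_closed by (intro degree) auto
    ultimately show ?thesis by simp
  qed
  have D_refl: "D b b = \<one>\<^bsub>\<Gamma>\<^esub>" if "b \<in> Obj B" for b
    using cocycle[OF that that that] D(1)[OF that that] \<Gamma>.l_cancel_one by blast
  have D_inv: "inv\<^bsub>\<Gamma>\<^esub> D b c = D c b" if "b \<in> Obj B" "c \<in> Obj B" for b c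
    using cocycle[of b c b] D(1) D_refl that by (intro \<Gamma>.inv_equality) auto
  have walk: "walk_degree \<Gamma> X ws = D u v \<and> u \<in> Obj B \<and> v \<in> Obj B"
    if "nonzero_walk B u v ws" for u v ws
    using that
  proof (induction ws arbitrary: v)
    case Nil
    then show ?case by (simp add: nonzero_walk_def)
  next
    case (Cons w ws)
    obtain b c f \<epsilon> where w: "w = (b, c, f, \<epsilon>)" by (cases w)
    have bc: "b \<in> Obj B" "c \<in> Obj B" and f: "f \<in> carrier (Hom B b c)" "f \<noteq> \<zero>\<^bsub>Hom B b c\<^esub>"
      and \<epsilon>: "\<epsilon> = 1 \<or> \<epsilon> = -1" and v: "step_target w = v"
      using Cons.prems by (auto simp: nonzero_walk_def w)
    have endpoints: "step_source w \<in> Obj B" "step_target w \<in> Obj B" using bc by (auto simp: w)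
    have step: "mor_degree \<Gamma> X b c f [^]\<^bsub>\<Gamma>\<^esub> \<epsilon> = D (step_source w) (step_target w)"
    proof (cases "\<epsilon> = 1")
      case True
      then show ?thesis using degree[OF bc f] D(1)[OF bc] by (simp add: w)
    next
      case False
      then have "\<epsilon> = -1" using \<epsilon> by blast
      then show ?thesis
        using degree[OF bc f] D(1)[OF bc] D_inv[OF bc] \<Gamma>.int_pow_neg[of "D b c" 1]
        by (simp add: w)
    qed
    \<comment> \<open>The head of the list is the last step of the walk, so the tail is a walk to its source.\<close>
    show ?case
    proof (cases "ws = []")
      case True
      then have "u = step_source w" using Cons.prems by (simp add: nonzero_walk_def)
      then show ?thesis using True step endpoints v D(1) by (simp add: w)
    next
      case False
      then have "nonzero_walk B u (step_source w) ws"
        using Cons.prems by (auto simp: nonzero_walk_def successively_Cons)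
      from Cons.IH[OF this] show ?thesis
        using step endpoints v cocycle by (simp add: w)
    qed
  qed
  obtain b where b: "b \<in> Obj B" using nonempty by blast
  have "s = \<one>\<^bsub>\<Gamma>\<^esub>" if s: "s \<in> carrier \<Gamma>" for s
    using connected b s walk D_refl unfolding connected_grading_def by metis
  then show ?thesis using \<Gamma>.trivial_group_subset by blast
qed

section \<open>Smash products\<close>

lemma smash_product_simps:
  "Obj (smash_product B \<Gamma> X) = Obj B \<times> carrier \<Gamma>"
  "Hom (smash_product B \<Gamma> X) (b, g) (c, h) = (Hom B b c)\<lparr>carrier := X (inv\<^bsub>\<Gamma>\<^esub> h \<otimes>\<^bsub>\<Gamma>\<^esub> g) b c\<rparr>"
  "Comp (smash_product B \<Gamma> X) (b, g) (c, h) (d, l) = Comp B b c d"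
  "Ident (smash_product B \<Gamma> X) (b, g) = Ident B b"
  by (simp_all add: smash_product_def)

text \<open>
  Composition stays inside the chosen components because the degrees telescope:
  \<open>l\<inverse> h \<otimes> h\<inverse> g = l\<inverse> g\<close>.
\<close>
lemma (in grading) k_category_smash_product:
  assumes unit: "\<And>b. b \<in> Obj B \<Longrightarrow> Ident B b \<in> X \<one>\<^bsub>\<Gamma>\<^esub> b b"
  shows "k_category K (smash_product B \<Gamma> X)"
proof -
  have X: "subspace K (X s b c) (Hom B b c)"
    if "b \<in> Obj B" "c \<in> Obj B" "s \<in> carrier \<Gamma>" for b c s
    using decomposition_subspace[OF decomposition] that by blast
  have in_Hom: "f \<in> carrier (Hom B b c)"
    if "f \<in> X (inv\<^bsub>\<Gamma>\<^esub> h \<otimes>\<^bsub>\<Gamma>\<^esub> g) b c" "b \<in> Obj B" "c \<in> Obj B" "g \<in> carrier \<Gamma>" "h \<in> carrier \<Gamma>"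
    for b c g h f
    using subspace_mem(1)[OF X[of b c "inv\<^bsub>\<Gamma>\<^esub> h \<otimes>\<^bsub>\<Gamma>\<^esub> g"]] that by auto
  have deg: "inv\<^bsub>\<Gamma>\<^esub> l \<otimes>\<^bsub>\<Gamma>\<^esub> h \<otimes>\<^bsub>\<Gamma>\<^esub> (inv\<^bsub>\<Gamma>\<^esub> h \<otimes>\<^bsub>\<Gamma>\<^esub> g) = inv\<^bsub>\<Gamma>\<^esub> l \<otimes>\<^bsub>\<Gamma>\<^esub> g"
    if "g \<in> carrier \<Gamma>" "h \<in> carrier \<Gamma>" "l \<in> carrier \<Gamma>" for g h l
  proof -
    have "h \<otimes>\<^bsub>\<Gamma>\<^esub> (inv\<^bsub>\<Gamma>\<^esub> h \<otimes>\<^bsub>\<Gamma>\<^esub> g) = g" using that by (simp flip: \<Gamma>.m_assoc)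
    then show ?thesis using that by (simp add: \<Gamma>.m_assoc)
  qed
  show ?thesis
  proof (intro k_category.intro k_category_axioms.intro field_axioms, unfold smash_product_simps(1))
    fix u v assume "u \<in> Obj B \<times> carrier \<Gamma>" "v \<in> Obj B \<times> carrier \<Gamma>"
    then show "vectorspace K (Hom (smash_product B \<Gamma> X) u v)"
      using vectorspace.subspace_is_vs[OF Hom_vectorspace X]
      by (auto simp: smash_product_simps)
  next
    fix u v w f g
    assume "u \<in> Obj B \<times> carrier \<Gamma>" "v \<in> Obj B \<times> carrier \<Gamma>" "w \<in> Obj B \<times> carrier \<Gamma>"
      "f \<in> carrier (Hom (smash_product B \<Gamma> X) u v)" "g \<in> carrier (Hom (smash_product B \<Gamma> X) v w)"
    moreover obtain b g\<^sub>1 c h d l where "u = (b, g\<^sub>1)" "v = (c, h)" "w = (d, l)"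
      by (cases u, cases v, cases w)
    ultimately show "Comp (smash_product B \<Gamma> X) u v w g f \<in> carrier (Hom (smash_product B \<Gamma> X) u w)"
      using graded_Comp[of b c d "inv\<^bsub>\<Gamma>\<^esub> h \<otimes>\<^bsub>\<Gamma>\<^esub> g\<^sub>1" "inv\<^bsub>\<Gamma>\<^esub> l \<otimes>\<^bsub>\<Gamma>\<^esub> h" f g]
      by (simp add: smash_product_simps deg)
  next
    fix u assume "u \<in> Obj B \<times> carrier \<Gamma>"
    then show "Ident (smash_product B \<Gamma> X) u \<in> carrier (Hom (smash_product B \<Gamma> X) u u)"
      using unit by (auto simp: smash_product_simps)
  qed (clarsimp simp: smash_product_simps, (rule Comp_add_left Comp_add_right Comp_smult_left
      Comp_smult_right Comp_assoc Ident_left Ident_right;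
      (assumption | (erule in_Hom; assumption))+))+
qed

text \<open>
  The smash product inherits one-dimensional morphism spaces and non-vanishing composites from the
  homogeneous components. Since every component is non-zero, any two of its objects are joined by
  a walk of length one.
\<close>
lemma (in grading) simply_connected_smash_product:
  assumes nonempty: "Obj B \<noteq> {}" and unit: "\<And>b. b \<in> Obj B \<Longrightarrow> Ident B b \<in> X \<one>\<^bsub>\<Gamma>\<^esub> b b"
    and line: "\<And>s b c. \<lbrakk>s \<in> carrier \<Gamma>; b \<in> Obj B; c \<in> Obj B\<rbrakk> \<Longrightarrow> \<exists>e\<in>X s b c.
        e \<noteq> \<zero>\<^bsub>Hom B b c\<^esub> \<and> (\<forall>f\<in>X s b c. \<exists>a\<in>carrier K. f = a \<odot>\<^bsub>Hom B b c\<^esub> e)"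
    and nonzero: "\<And>r s b c d f g. \<lbrakk>r \<in> carrier \<Gamma>; s \<in> carrier \<Gamma>;
        b \<in> Obj B; c \<in> Obj B; d \<in> Obj B; f \<in> X s b c; f \<noteq> \<zero>\<^bsub>Hom B b c\<^esub>;
        g \<in> X r c d; g \<noteq> \<zero>\<^bsub>Hom B c d\<^esub>\<rbrakk> \<Longrightarrow> Comp B b c d g f \<noteq> \<zero>\<^bsub>Hom B b d\<^esub>"
  shows "simply_connected_kcat TYPE('t) K (smash_product B \<Gamma> X)"
  unfolding simply_connected_kcat_def
proof (intro conjI allI impI)
  let ?S = "smash_product B \<Gamma> X"
  show "k_category K ?S" by (rule k_category_smash_product[OF unit])
  have S_line: "\<exists>e\<in>carrier (Hom ?S u v). e \<noteq> \<zero>\<^bsub>Hom ?S u v\<^esub> \<and>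
        (\<forall>f\<in>carrier (Hom ?S u v). \<exists>a\<in>carrier K. f = a \<odot>\<^bsub>Hom ?S u v\<^esub> e)"
    if "u \<in> Obj ?S" "v \<in> Obj ?S" for u v
    using that line by (auto simp: smash_product_simps)
  show "connected_kcat ?S"
    unfolding connected_kcat_def
  proof (intro ballI)
    fix u v assume uv: "u \<in> Obj ?S" "v \<in> Obj ?S"
    then obtain e where "e \<in> carrier (Hom ?S u v)" "e \<noteq> \<zero>\<^bsub>Hom ?S u v\<^esub>" using S_line by blast
    then have "nonzero_walk ?S u v [(u, v, e, 1)]" using uv by (simp add: nonzero_walk_def)
    then show "\<exists>ws. nonzero_walk ?S u v ws" ..
  qed
  fix \<Delta> :: "'t monoid" and Y
  assume "connected_grading K ?S \<Delta> Y"
  then show "trivial_group \<Delta>"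
  proof (rule connected_grading_trivial[OF _ _ S_line])
    show "Obj ?S \<noteq> {}" using nonempty \<Gamma>.one_closed by (auto simp: smash_product_simps)
  next
    fix u v w f g
    assume "u \<in> Obj ?S" "v \<in> Obj ?S" "w \<in> Obj ?S"
      "f \<in> carrier (Hom ?S u v)" "f \<noteq> \<zero>\<^bsub>Hom ?S u v\<^esub>"
      "g \<in> carrier (Hom ?S v w)" "g \<noteq> \<zero>\<^bsub>Hom ?S v w\<^esub>"
    moreover obtain b g\<^sub>1 c h d l where "u = (b, g\<^sub>1)" "v = (c, h)" "w = (d, l)"
      by (cases u, cases v, cases w)
    ultimately show "Comp ?S u v w g f \<noteq> \<zero>\<^bsub>Hom ?S u w\<^esub>"
      using nonzero[of "inv\<^bsub>\<Gamma>\<^esub> l \<otimes>\<^bsub>\<Gamma>\<^esub> h" "inv\<^bsub>\<Gamma>\<^esub> h \<otimes>\<^bsub>\<Gamma>\<^esub> g\<^sub>1" b c d f g]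
      by (simp add: smash_product_simps)
  qed
qed

section \<open>Primitive roots of unity\<close>

lemma primitive_root_power_mod:
  assumes "primitive_root_of_unity n q"
  shows "q ^ (a mod n) = q ^ a"
proof -
  have "q ^ a = q ^ (n * (a div n) + a mod n)" by simp
  also have "\<dots> = q ^ (a mod n)"
    using assms unfolding primitive_root_of_unity_def by (simp only: power_add power_mult) simp
  finally show ?thesis by simp
qed

lemma power_commuting: "(x ^ m) ^ n = (x ^ n) ^ m" for x :: "'a::monoid_mult"
  by (simp add: mult.commute flip: power_mult)

lemma primitive_root_nonzero:
  "primitive_root_of_unity n q \<Longrightarrow> q \<noteq> 0"
  unfolding primitive_root_of_unity_def by (metis power_0_left not_gr_zero zero_neq_one)

lemma primitive_root_power_eq_iff:
  assumes q: "primitive_root_of_unity n q"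
  shows "q ^ a = q ^ b \<longleftrightarrow> a mod n = b mod n"
proof -
  have n: "0 < n" and minimal: "\<And>m. \<lbrakk>0 < m; m < n\<rbrakk> \<Longrightarrow> q ^ m \<noteq> 1"
    using q unfolding primitive_root_of_unity_def by blast+
  have distinct: "q ^ i \<noteq> q ^ j" if "i < j" "j < n" for i j
  proof
    assume "q ^ i = q ^ j"
    also have "q ^ j = q ^ i * q ^ (j - i)" using that by (simp flip: power_add)
    finally have "q ^ (j - i) = 1" using primitive_root_nonzero[OF q] by simp
    then show False using minimal[of "j - i"] that by simp
  qed
  have "q ^ (a mod n) = q ^ (b mod n) \<longleftrightarrow> a mod n = b mod n"
    using distinct[of "a mod n" "b mod n"] distinct[of "b mod n" "a mod n"] n
    by (cases "a mod n" "b mod n" rule: linorder_cases) auto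
  then show ?thesis unfolding primitive_root_power_mod[OF q] .
qed

lemma sum_powers_of_root_of_unity:
  fixes w :: "'k::field"
  assumes "w ^ n = 1"
  shows "(\<Sum>c<n. w ^ c) = (if w = 1 then of_nat n else 0)"
  using assms by (simp add: geometric_sum)

text \<open>
  The characteristic of a field with a primitive \<open>n\<close>-th root of unity does not divide \<open>n\<close>: otherwise
  \<open>1 + X + \<dots> + X\<^sup>n\<^sup>-\<^sup>1\<close> would vanish at \<open>1\<close> as well as at the other powers of \<open>q\<close>, hence at
  \<open>n\<close> points, more than its degree allows. This makes the division by \<open>n\<close> in the Fourier inversion
  legitimate.
\<close>
lemma primitive_root_of_nat_nonzero:
  fixes q :: "'k::field"
  assumes q: "primitive_root_of_unity n q"
  shows "of_nat n \<noteq> (0 :: 'k)"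
proof
  assume n0: "of_nat n = (0 :: 'k)"
  have n: "n > 0" using q unfolding primitive_root_of_unity_def by blast
  let ?p = "\<Sum>j<n. monom (1 :: 'k) j"
  have "coeff ?p 0 = (\<Sum>j<n. if j = 0 then 1 else 0)"
    unfolding coeff_sum coeff_monom by (rule sum.cong) auto
  also have "\<dots> = 1" using n by simp
  finally have p: "?p \<noteq> 0" by auto
  have "poly ?p (q ^ m) = 0" for m
  proof -
    have "(q ^ m) ^ n = 1"
      using q unfolding primitive_root_of_unity_def by (simp add: power_commuting[of q m n])
    then have "(\<Sum>j<n. (q ^ m) ^ j) = 0"
      using sum_powers_of_root_of_unity[of "q ^ m" n] n0 by simp
    then show ?thesis by (simp add: poly_sum poly_monom)
  qed
  then have "(\<lambda>m. q ^ m) ` {..<n} \<subseteq> {x. poly ?p x = 0}" by blast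
  then have "card ((\<lambda>m. q ^ m) ` {..<n}) \<le> card {x. poly ?p x = 0}"
    using p poly_roots_finite card_mono by blast
  also have "\<dots> \<le> degree ?p" by (rule card_poly_roots_bound[OF p])
  also have "degree ?p \<le> n - 1"
    by (rule degree_sum_le) (auto intro: order_trans[OF degree_monom_le])
  also have "card ((\<lambda>m. q ^ m) ` {..<n}) = n"
    using primitive_root_power_eq_iff[OF q] by (subst card_image) (auto intro!: inj_onI)
  finally show False using n by simp
qed

text \<open>
  Orthogonality of the characters of the cyclic group of order \<open>n\<close>: the sum is a geometric one
  with ratio \<open>q\<^sup>a / q\<^sup>b\<close>, an \<open>n\<close>-th root of unity.
\<close>
lemma primitive_root_orthogonality:
  assumes q: "primitive_root_of_unity n q"
  shows "(\<Sum>c<n. q ^ (c * a) / q ^ (c * b)) = (if a mod n = b mod n then of_nat n else 0)"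
proof -
  let ?w = "q ^ a / q ^ b"
  have "q ^ n = 1" using q unfolding primitive_root_of_unity_def by blast
  then have "?w ^ n = 1" by (simp add: power_divide power_commuting[of q _ n])
  moreover have "?w = 1 \<longleftrightarrow> a mod n = b mod n"
    using primitive_root_power_eq_iff[OF q, of a b] primitive_root_nonzero[OF q] by simp
  moreover have "(\<Sum>c<n. q ^ (c * a) / q ^ (c * b)) = (\<Sum>c<n. ?w ^ c)"
    by (simp add: power_divide power_mult power_commuting[of q _ a] power_commuting[of q _ b])
  ultimately show ?thesis by (simp only: sum_powers_of_root_of_unity)
qed

section \<open>Monomials in the clock and shift matrices\<close>

text \<open>
  The monomial \<open>x\<^sup>i y\<^sup>j\<close>. Columns are counted from \<open>0\<close> but the eigenvalue of \<open>y\<close> on the first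
  basis vector is \<open>q\<close>, whence the exponent \<open>Suc c\<close>.
\<close>
definition clock_shift :: "nat \<Rightarrow> 'k::field \<Rightarrow> nat \<Rightarrow> nat \<Rightarrow> 'k mat" where
  "clock_shift n q i j = mat n n (\<lambda>(r, c). if r = (c + i) mod n then q ^ (j * Suc c) else 0)"

lemma clock_shift_carrier [simp]: "clock_shift n q i j \<in> carrier_mat n n"
  by (simp add: clock_shift_def)

lemma clock_shift_index:
  "\<lbrakk>r < n; c < n\<rbrakk> \<Longrightarrow>
    clock_shift n q i j $$ (r, c) = (if r = (c + i) mod n then q ^ (j * Suc c) else 0)"
  by (simp add: clock_shift_def)

lemma clock_shift_mod:
  assumes "primitive_root_of_unity n q"
  shows "clock_shift n q (i mod n) (j mod n) = clock_shift n q i j"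
proof -
  have "q ^ (j mod n * Suc c) = q ^ (j * Suc c)" for c
    unfolding primitive_root_power_eq_iff[OF assms] by (rule mod_mult_left_eq)
  then show ?thesis unfolding clock_shift_def by (auto simp: mod_add_right_eq)
qed

lemma clock_shift_nonzero:
  assumes "primitive_root_of_unity n q"
  shows "clock_shift n q i j \<noteq> 0\<^sub>m n n"
proof
  assume "clock_shift n q i j = 0\<^sub>m n n"
  moreover have "n > 0" using assms unfolding primitive_root_of_unity_def by blast
  ultimately have "q ^ j = 0"
    using clock_shift_index[of "i mod n" n 0 q i j] by simp
  then show False using primitive_root_nonzero[OF assms] by simp
qed

lemma clock_shift_0_0: "clock_shift n q 0 0 = 1\<^sub>m n"
  by (rule eq_matI) (auto simp: clock_shift_def)

text \<open>
  Moving \<open>y\<^sup>j\<close> past \<open>x\<^sup>k\<close> costs the scalar \<open>q\<^bsup>jk\<^esup>\<close>, as dictated by \<open>y x = q x y\<close>.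
\<close>
lemma clock_shift_mult:
  assumes q: "primitive_root_of_unity n q"
  shows "clock_shift n q i j * clock_shift n q k l =
    q ^ (j * k) \<cdot>\<^sub>m clock_shift n q (i + k) (j + l)" (is "?A * ?B = ?C")
proof (rule eq_matI)
  fix r c assume "r < dim_row ?C" "c < dim_col ?C"
  then have rc: "r < n" "c < n" by (simp_all add: clock_shift_def)
  let ?s = "(c + k) mod n"
  have s: "?s < n" using rc by simp
  have "(?A * ?B) $$ (r, c) = (\<Sum>s<n. ?A $$ (r, s) * ?B $$ (s, c))"
    using rc by (simp add: clock_shift_def scalar_prod_def lessThan_atLeast0)
  also have "\<dots> = (\<Sum>s<n. if s = ?s then ?A $$ (r, s) * q ^ (l * Suc c) else 0)"
    using rc by (intro sum.cong) (auto simp: clock_shift_index)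
  also have "\<dots> = ?A $$ (r, ?s) * q ^ (l * Suc c)" using s by simp
  also have "\<dots> = (if r = (?s + i) mod n then q ^ (j * Suc ?s) else 0) * q ^ (l * Suc c)"
    by (simp only: clock_shift_index[OF rc(1) s])
  also have "(?s + i) mod n = (c + (i + k)) mod n" by (simp add: mod_simps ac_simps)
  also have "q ^ (j * Suc ?s) = q ^ (j * Suc (c + k))"
    unfolding primitive_root_power_eq_iff[OF q]
    by (subst (1 2) mod_mult_right_eq[symmetric]) (simp only: mod_Suc_eq)
  also have "q ^ (j * Suc (c + k)) = q ^ (j * k) * q ^ (j * Suc c)"
    by (simp add: algebra_simps flip: power_add)
  finally show "(?A * ?B) $$ (r, c) = ?C $$ (r, c)"
    using rc by (simp add: clock_shift_def add_mult_distrib power_add)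
qed (simp_all add: clock_shift_def)

lemma mult_mat_unit_vec_index:
  fixes A :: "'k::field mat"
  assumes "A \<in> carrier_mat n n" "r < n" "c < n"
  shows "(A *\<^sub>v unit_vec n c) $ r = A $$ (r, c)"
  using assms by simp

lemma shift_matrix_eq:
  assumes q: "primitive_root_of_unity n q" and x: "shift_matrix n x"
  shows "x = clock_shift n q 1 0"
proof (rule eq_matI)
  fix r c assume "r < dim_row (clock_shift n q 1 0)" "c < dim_col (clock_shift n q 1 0)"
  then have rc: "r < n" "c < n" by (simp_all add: clock_shift_def)
  have "x *\<^sub>v unit_vec n c = unit_vec n (Suc c mod n)"
  proof (cases "Suc c < n")
    case True
    then show ?thesis using x spec[of _ "Suc c"] unfolding shift_matrix_def by fastforce
  next
    case False
    then have "Suc c = n" using rc by simp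
    then show ?thesis using x unfolding shift_matrix_def by auto
  qed
  then have "x $$ (r, c) = unit_vec n (Suc c mod n) $ r"
    using mult_mat_unit_vec_index[of x n r c] x rc unfolding shift_matrix_def by simp
  also have "\<dots> = clock_shift n q 1 0 $$ (r, c)" using rc by (simp add: clock_shift_index)
  finally show "x $$ (r, c) = clock_shift n q 1 0 $$ (r, c)" .
qed (use x in \<open>auto simp: shift_matrix_def clock_shift_def\<close>)

lemma clock_matrix_eq:
  assumes y: "clock_matrix n q y"
  shows "y = clock_shift n q 0 1"
proof (rule eq_matI)
  fix r c assume "r < dim_row (clock_shift n q 0 1)" "c < dim_col (clock_shift n q 0 1)"
  then have rc: "r < n" "c < n" by (simp_all add: clock_shift_def)
  have "y *\<^sub>v unit_vec n c = q ^ Suc c \<cdot>\<^sub>v unit_vec n c"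
    using y rc unfolding clock_matrix_def by (auto dest!: spec[of _ "Suc c"])
  then have "y $$ (r, c) = (q ^ Suc c \<cdot>\<^sub>v unit_vec n c) $ r"
    using mult_mat_unit_vec_index[of y n r c] y rc unfolding clock_matrix_def by simp
  also have "\<dots> = clock_shift n q 0 1 $$ (r, c)" using rc by (simp add: clock_shift_index)
  finally show "y $$ (r, c) = clock_shift n q 0 1 $$ (r, c)" .
qed (use y in \<open>auto simp: clock_matrix_def clock_shift_def\<close>)

section \<open>Expansion of matrices into monomials\<close>

text \<open>
  The coefficient of \<open>x\<^sup>i y\<^sup>j\<close> in \<open>A\<close>. It is an inverse discrete Fourier transform of the \<open>i\<close>-th
  cyclic diagonal of \<open>A\<close>, that is, of the entries that \<open>x\<^sup>i y\<^sup>j\<close> can reach.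
\<close>
definition clock_shift_coeff :: "nat \<Rightarrow> 'k::field \<Rightarrow> nat \<Rightarrow> nat \<Rightarrow> 'k mat \<Rightarrow> 'k" where
  "clock_shift_coeff n q i j A = (\<Sum>c<n. A $$ ((c + i) mod n, c) / q ^ (j * Suc c)) / of_nat n"

lemma clock_shift_coeff_add:
  assumes "A \<in> carrier_mat n n" "B \<in> carrier_mat n n"
  shows "clock_shift_coeff n q i j (A + B) = clock_shift_coeff n q i j A + clock_shift_coeff n q i j B"
  using assms by (simp add: clock_shift_coeff_def add_divide_distrib sum.distrib)

lemma clock_shift_coeff_smult:
  assumes "A \<in> carrier_mat n n"
  shows "clock_shift_coeff n q i j (a \<cdot>\<^sub>m A) = a * clock_shift_coeff n q i j A"
  using assms by (simp add: clock_shift_coeff_def sum_distrib_left)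

lemma clock_shift_coeff_clock_shift:
  assumes q: "primitive_root_of_unity n q"
  shows "clock_shift_coeff n q i j (clock_shift n q k l) =
    (if i mod n = k mod n \<and> j mod n = l mod n then 1 else 0)"
proof -
  have shift: "(c + i) mod n = (c + k) mod n \<longleftrightarrow> i mod n = k mod n" for c
    using cong_add_lcancel_nat[of c i k n] unfolding cong_def .
  \<comment> \<open>The columns start at exponent \<open>1\<close>, which splits off the factor \<open>q\<^sup>l / q\<^sup>j\<close>; it equals \<open>1\<close> in the
      only case in which the character sum survives.\<close>
  have "(\<Sum>c<n. q ^ (l * Suc c) / q ^ (j * Suc c)) =
      q ^ l / q ^ j * (\<Sum>c<n. q ^ (c * l) / q ^ (c * j))"
    unfolding sum_distrib_left by (intro sum.cong) (simp_all add: power_add ac_simps)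
  also have "\<dots> = (if j mod n = l mod n then of_nat n else 0)"
  proof (cases "j mod n = l mod n")
    case True
    then have "q ^ l = q ^ j" using primitive_root_power_eq_iff[OF q] by metis
    then show ?thesis using True primitive_root_nonzero[OF q] primitive_root_orthogonality[OF q] by simp
  next
    case False
    then show ?thesis using primitive_root_orthogonality[OF q, of l j] by simp
  qed
  finally have sum: "(\<Sum>c<n. q ^ (l * Suc c) / q ^ (j * Suc c)) =
    (if j mod n = l mod n then of_nat n else 0)" .
  have "clock_shift_coeff n q i j (clock_shift n q k l) =
    (\<Sum>c<n. if i mod n = k mod n then q ^ (l * Suc c) / q ^ (j * Suc c) else 0) / of_nat n"
    unfolding clock_shift_coeff_def
    by (intro arg_cong2[of _ _ _ _ "(/)"] sum.cong) (auto simp: clock_shift_index shift)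
  then show ?thesis
    using primitive_root_of_nat_nonzero[OF q]
    by (cases "i mod n = k mod n") (simp_all add: sum del: mult_Suc_right)
qed

text \<open>
  Exchanging the sums over \<open>j\<close> and over the positions \<open>d\<close> of the diagonal, orthogonality leaves
  only the position \<open>d = c\<close>.
\<close>
lemma clock_shift_expansion:
  assumes q: "primitive_root_of_unity n q" and A: "A \<in> carrier_mat n n" and rc: "r < n" "c < n"
  shows "A $$ (r, c) = (\<Sum>i<n. \<Sum>j<n. clock_shift_coeff n q i j A * clock_shift n q i j $$ (r, c))"
proof -
  have n: "of_nat n \<noteq> (0 :: 'a)" by (rule primitive_root_of_nat_nonzero[OF q])
  \<comment> \<open>The only shift that carries column \<open>c\<close> to row \<open>r\<close>.\<close>
  define i where "i = (r + (n - c)) mod n"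
  have i: "i < n" "(c + i) mod n = r" using rc by (simp_all add: i_def mod_simps)
  have i_unique: "r = (c + k) mod n \<longleftrightarrow> k = i" if "k < n" for k
    using that i cong_add_lcancel_nat[of c k i n] unfolding cong_def by auto
  have "(\<Sum>k<n. \<Sum>j<n. clock_shift_coeff n q k j A * clock_shift n q k j $$ (r, c)) =
      (\<Sum>k<n. if k = i then \<Sum>j<n. clock_shift_coeff n q i j A * q ^ (j * Suc c) else 0)"
    using rc i_unique by (intro sum.cong) (auto simp: clock_shift_index)
  also have "\<dots> = (\<Sum>j<n. clock_shift_coeff n q i j A * q ^ (j * Suc c))" using i by simp
  also have "\<dots> = (\<Sum>j<n. \<Sum>d<n. A $$ ((d + i) mod n, d) / of_nat n *
      (q ^ (j * Suc c) / q ^ (j * Suc d)))"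
    unfolding clock_shift_coeff_def sum_divide_distrib sum_distrib_right
    by (intro sum.cong) simp_all
  also have "\<dots> = (\<Sum>d<n. A $$ ((d + i) mod n, d) / of_nat n *
      (\<Sum>j<n. q ^ (j * Suc c) / q ^ (j * Suc d)))"
    unfolding sum_distrib_left by (rule sum.swap)
  also have "\<dots> = (\<Sum>d<n. if d = c then A $$ (r, c) else 0)"
  proof (intro sum.cong refl)
    fix d assume "d \<in> {..<n}"
    then have "Suc c mod n = Suc d mod n \<longleftrightarrow> d = c"
      using rc cong_add_rcancel_nat[of c 1 d n] unfolding cong_def by auto
    then show "A $$ ((d + i) mod n, d) / of_nat n * (\<Sum>j<n. q ^ (j * Suc c) / q ^ (j * Suc d)) =
        (if d = c then A $$ (r, c) else 0)"
      using primitive_root_orthogonality[OF q, of "Suc c" "Suc d"] n i by simp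
  qed
  also have "\<dots> = A $$ (r, c)" using rc by simp
  finally show ?thesis by simp
qed

section \<open>The grading of the matrix algebra\<close>

lemma k_category_matrix_algebra:
  "k_category (class_ring :: 'k::field ring) (one_object_kcat (module_mat TYPE('k) n n))"
proof -
  have "field (class_ring :: 'k ring)" by (rule vectorspace.axioms(2)[OF matrix_vs])
  then show ?thesis
    by (intro k_category.intro k_category_axioms.intro)
      (auto simp: one_object_kcat_def module_mat_simps class_ring_simps matrix_vs
        add_mult_distrib_mat mult_add_distrib_mat assoc_mult_mat)
qed

lemma smult_smult_mat: "a \<cdot>\<^sub>m (b \<cdot>\<^sub>m A) = (a * b) \<cdot>\<^sub>m A" for A :: "'a::semigroup_mult mat"
  by (rule eq_matI) (simp_all add: mult.assoc)

lemma one_smult_mat: "1 \<cdot>\<^sub>m A = A" for A :: "'a::monoid_mult mat"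
  by (rule eq_matI) simp_all

lemma finsum_mat_index:
  fixes f :: "'s \<Rightarrow> 'k::field mat"
  assumes "finite S" "\<And>s. s \<in> S \<Longrightarrow> f s \<in> carrier_mat n m" "r < n" "c < m"
  shows "finsum (module_mat TYPE('k) n m) f S $$ (r, c) = (\<Sum>s\<in>S. f s $$ (r, c))"
proof -
  interpret matrix_vs n m "TYPE('k)" .
  show ?thesis
    using assms(1,2)
  proof (induction S rule: finite_induct)
    case empty
    then show ?case using assms(3,4) by simp
  next
    case (insert s S)
    then have "finsum V f (insert s S) = f s + finsum V f S"
      by (intro M.finsum_insert) auto
    moreover have "finsum V f S \<in> carrier_mat n m"
      using insert.prems by (intro M.finsum_closed) auto
    then have "dim_row (finsum V f S) = n" "dim_col (finsum V f S) = m" by blast+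
    ultimately show ?case using insert assms(3,4) by simp
  qed
qed

locale cyclic_clock_shift = group C for C :: "'c monoid" (structure) +
  fixes n :: nat and q :: "'k::field" and t :: 'c
  assumes q: "primitive_root_of_unity n q"
    and order: "Coset.order C = n" and t: "t \<in> carrier C" and generate: "generate C {t} = carrier C"
begin

lemma n_pos: "n > 0"
  using q unfolding primitive_root_of_unity_def by blast

lemma ord_t: "ord t = n"
  using generate_pow_card[OF t] generate order unfolding Coset.order_def by simp

text \<open>
  Since \<open>t\<close> generates a group of order \<open>n\<close>, its own order is \<open>n\<close>; exponents matter modulo \<open>n\<close> only,
  as they do for clock and shift matrices.
\<close>
lemma pow_eq_iff: "t [^] i = t [^] j \<longleftrightarrow> i mod n = j mod n" for i j :: nat
proof -
  have "t [^] i = t [^] j \<longleftrightarrow> t [^] int i = t [^] int j" by (simp add: int_pow_int)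
  also have "\<dots> \<longleftrightarrow> int n dvd int j - int i" using int_pow_eq[OF t] ord_t by simp
  also have "\<dots> \<longleftrightarrow> int j mod int n = int i mod int n" by (rule mod_eq_dvd_iff[symmetric])
  also have "\<dots> \<longleftrightarrow> i mod n = j mod n" by (metis of_nat_eq_iff zmod_int)
  finally show ?thesis .
qed

lemma pow_surj:
  assumes "g \<in> carrier C"
  obtains i :: nat where "i < n" "g = t [^] i"
proof -
  have "g \<in> {t [^] k |k. k \<in> (UNIV :: nat set)}"
    using generate_pow_nat[OF t] ord_t n_pos generate assms by simp
  then obtain k :: nat where "g = t [^] k" by blast
  then show thesis using that[of "k mod n"] pow_eq_iff[of k "k mod n"] n_pos by simp
qed

definition discrete_log :: "'c \<Rightarrow> nat" where
  "discrete_log g = (SOME i. i < n \<and> g = t [^] i)"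

lemma discrete_log:
  assumes "g \<in> carrier C"
  shows "discrete_log g < n" "t [^] discrete_log g = g"
proof -
  have "\<exists>i. i < n \<and> g = t [^] i" using pow_surj[OF assms] by metis
  from someI_ex[OF this, folded discrete_log_def] show "discrete_log g < n" "t [^] discrete_log g = g" by simp_all
qed

lemma discrete_log_pow: "discrete_log (t [^] i) = i mod n"
proof -
  have "t [^] i \<in> carrier C" using t by simp
  note discrete_log[OF this]
  then show ?thesis using pow_eq_iff[of "discrete_log (t [^] i)" i] by simp
qed

lemma pow_pair_bij: "bij_betw (\<lambda>(i, j). (t [^] i, t [^] j)) ({..<n} \<times> {..<n}) (carrier C \<times> carrier C)"
  using t by (intro bij_betwI[where g = "\<lambda>(g, h). (discrete_log g, discrete_log h)"]) (auto simp: discrete_log discrete_log_pow)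

lemma degree_cases:
  assumes "s \<in> carrier (C \<times>\<times> C)"
  obtains i j :: nat where "s = (t [^] i, t [^] j)"
proof -
  obtain g h where s: "s = (g, h)" "g \<in> carrier C" "h \<in> carrier C" using assms by auto
  obtain i :: nat where "g = t [^] i" by (rule pow_surj[OF s(2)])
  moreover obtain j :: nat where "h = t [^] j" by (rule pow_surj[OF s(3)])
  ultimately show thesis using s(1) that by blast
qed

definition monomial :: "'c \<times> 'c \<Rightarrow> 'k mat" where
  "monomial s = clock_shift n q (discrete_log (fst s)) (discrete_log (snd s))"

text \<open>
  A category with one object has only one pair of objects, which the last two arguments stand for.
\<close>
definition component :: "'c \<times> 'c \<Rightarrow> unit \<Rightarrow> unit \<Rightarrow> 'k mat set" where
  "component s _ _ = {a \<cdot>\<^sub>m monomial s |a. True}"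

lemma monomial_carrier [simp]: "monomial s \<in> carrier_mat n n"
  by (simp add: monomial_def)

lemma monomial_pow: "monomial (t [^] i, t [^] j) = clock_shift n q i j"
  by (simp add: monomial_def discrete_log_pow clock_shift_mod[OF q])

lemma monomial_nonzero: "monomial s \<noteq> 0\<^sub>m n n"
  unfolding monomial_def by (rule clock_shift_nonzero[OF q])

lemma monomial_one: "monomial (\<one>, \<one>) = 1\<^sub>m n"
  using monomial_pow[of 0 0] by (simp add: clock_shift_0_0)

lemma smult_monomial_eq_0_iff: "a \<cdot>\<^sub>m monomial s = 0\<^sub>m n n \<longleftrightarrow> a = 0"
proof
  assume zero: "a \<cdot>\<^sub>m monomial s = 0\<^sub>m n n"
  show "a = 0"
  proof (rule ccontr)
    assume "a \<noteq> 0"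
    then have "monomial s = inverse a \<cdot>\<^sub>m (a \<cdot>\<^sub>m monomial s)" by (simp add: smult_smult_mat one_smult_mat)
    then show False using monomial_nonzero zero by simp
  qed
qed (auto simp: monomial_def clock_shift_def)

lemma monomial_mult:
  assumes "r \<in> carrier (C \<times>\<times> C)" "s \<in> carrier (C \<times>\<times> C)"
  shows "\<exists>a. a \<noteq> 0 \<and> monomial r * monomial s = a \<cdot>\<^sub>m monomial (r \<otimes>\<^bsub>C \<times>\<times> C\<^esub> s)"
proof -
  obtain i j :: nat where r: "r = (t [^] i, t [^] j)" by (rule degree_cases[OF assms(1)])
  obtain k l :: nat where s: "s = (t [^] k, t [^] l)" by (rule degree_cases[OF assms(2)])
  have "r \<otimes>\<^bsub>C \<times>\<times> C\<^esub> s = (t [^] (i + k), t [^] (j + l))"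
    using t by (simp add: r s nat_pow_mult)
  then have "monomial r * monomial s = q ^ (j * k) \<cdot>\<^sub>m monomial (r \<otimes>\<^bsub>C \<times>\<times> C\<^esub> s)"
    by (simp only: r s monomial_pow clock_shift_mult[OF q])
  moreover have "q ^ (j * k) \<noteq> 0" using primitive_root_nonzero[OF q] by simp
  ultimately show ?thesis by blast
qed

text \<open>
  Non-zero homogeneous matrices multiply like the elements of a twisted group algebra: the scalar
  \<open>d\<close> never vanishes.
\<close>
lemma smult_monomial_mult:
  assumes "r \<in> carrier (C \<times>\<times> C)" "s \<in> carrier (C \<times>\<times> C)"
  obtains d where "d \<noteq> 0"
    "\<And>a b. (a \<cdot>\<^sub>m monomial r) * (b \<cdot>\<^sub>m monomial s) = (a * b * d) \<cdot>\<^sub>m monomial (r \<otimes>\<^bsub>C \<times>\<times> C\<^esub> s)"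
proof -
  obtain d where d: "d \<noteq> 0" "monomial r * monomial s = d \<cdot>\<^sub>m monomial (r \<otimes>\<^bsub>C \<times>\<times> C\<^esub> s)"
    using monomial_mult[OF assms] by blast
  have "(a \<cdot>\<^sub>m monomial r) * (b \<cdot>\<^sub>m monomial s) = (a * b * d) \<cdot>\<^sub>m monomial (r \<otimes>\<^bsub>C \<times>\<times> C\<^esub> s)" for a b
  proof -
    have "(a \<cdot>\<^sub>m monomial r) * (b \<cdot>\<^sub>m monomial s) = a \<cdot>\<^sub>m (monomial r * (b \<cdot>\<^sub>m monomial s))"
      by (rule mult_smult_assoc_mat[OF monomial_carrier, where nc = n]) simp
    also have "monomial r * (b \<cdot>\<^sub>m monomial s) = b \<cdot>\<^sub>m (monomial r * monomial s)"
      by (rule mult_smult_distrib[OF monomial_carrier monomial_carrier])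
    finally show ?thesis by (simp add: d(2) smult_smult_mat mult.assoc)
  qed
  with d(1) show thesis by (rule that)
qed

lemma component_subspace: "subspace class_ring (component s u v) (module_mat TYPE('k) n n)"
proof (intro subspace.intro matrix_vs LinearCombinations.submodule.intro)
  interpret vectorspace "class_ring :: 'k ring" "module_mat TYPE('k) n n" by (rule matrix_vs)
  show "Module.module (class_ring :: 'k ring) (module_mat TYPE('k) n n)" by (rule module_axioms)
next
  have "0\<^sub>m n n = 0 \<cdot>\<^sub>m monomial s" using smult_monomial_eq_0_iff[of 0 s] by simp
  then show "\<zero>\<^bsub>module_mat TYPE('k) n n\<^esub> \<in> component s u v"
    by (auto simp: module_mat_simps component_def)
qed (auto simp: module_mat_simps component_def smult_smult_mat
    simp flip: add_smult_distrib_right_mat[where nr = n and nc = n])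

text \<open>
  The projections onto the components read off the coefficient of one monomial.
\<close>
lemma component_decomposition:
  "direct_sum_decomposition class_ring (module_mat TYPE('k) n n) (carrier (C \<times>\<times> C))
    (\<lambda>s. component s u v)"
proof (rule decomposition_of_projections[where
      p = "\<lambda>s A. clock_shift_coeff n q (discrete_log (fst s)) (discrete_log (snd s)) A \<cdot>\<^sub>m monomial s"])
  let ?c = "\<lambda>s. clock_shift_coeff n q (discrete_log (fst s)) (discrete_log (snd s))"
  have finite: "finite (carrier C)"
    using order n_pos unfolding Coset.order_def by (intro card_ge_0_finite) simp
  then show "finite (carrier (C \<times>\<times> C))" by simp
  have coeff: "?c s (a \<cdot>\<^sub>m monomial r) = (if s = r then a else 0)"
    if "s \<in> carrier (C \<times>\<times> C)" "r \<in> carrier (C \<times>\<times> C)" for s r a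
  proof -
    have "s = r \<longleftrightarrow> discrete_log (fst s) mod n = discrete_log (fst r) mod n \<and> discrete_log (snd s) mod n = discrete_log (snd r) mod n"
      using that discrete_log by (metis carrier_DirProd mem_Times_iff mod_less prod_eq_iff)
    then show ?thesis
      by (simp add: clock_shift_coeff_smult monomial_def clock_shift_coeff_clock_shift[OF q])
  qed
  show "?c s A \<cdot>\<^sub>m monomial s = A" if "s \<in> carrier (C \<times>\<times> C)" "A \<in> component s u v" for s A
    using that coeff by (auto simp: component_def)
  show "?c s A \<cdot>\<^sub>m monomial s = \<zero>\<^bsub>module_mat TYPE('k) n n\<^esub>"
    if "s \<in> carrier (C \<times>\<times> C)" "r \<in> carrier (C \<times>\<times> C)" "s \<noteq> r" "A \<in> component r u v" for s r A
    using that(3,4) coeff[OF that(1,2)] smult_monomial_eq_0_iff[of 0 s]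
    by (auto simp: component_def module_mat_simps)
  show "A = (\<Oplus>\<^bsub>module_mat TYPE('k) n n\<^esub>s\<in>carrier (C \<times>\<times> C). ?c s A \<cdot>\<^sub>m monomial s)"
    (is "A = ?S") if "A \<in> carrier (module_mat TYPE('k) n n)" for A
  proof (rule eq_matI)
    have A: "A \<in> carrier_mat n n" using that by (simp add: module_mat_simps)
    interpret matrix_vs n n "TYPE('k)" .
    have "?S \<in> carrier_mat n n" by (rule M.finsum_closed) auto
    then have S: "dim_row ?S = n" "dim_col ?S = n" by blast+
    then show "dim_row A = dim_row ?S" "dim_col A = dim_col ?S" using A by auto
    fix r c assume "r < dim_row ?S" "c < dim_col ?S"
    then have rc: "r < n" "c < n" unfolding S .
    have "?S $$ (r, c) = (\<Sum>s\<in>carrier C \<times> carrier C. (?c s A \<cdot>\<^sub>m monomial s) $$ (r, c))"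
      using finite rc by (subst finsum_mat_index) auto
    also have "\<dots> = (\<Sum>(i, j)\<in>{..<n} \<times> {..<n}. clock_shift_coeff n q i j A * clock_shift n q i j $$ (r, c))"
      using rc by (subst sum.reindex_bij_betw[OF pow_pair_bij, symmetric])
        (auto intro!: sum.cong simp: discrete_log_pow monomial_pow clock_shift_def)
    also have "\<dots> = A $$ (r, c)"
      unfolding clock_shift_expansion[OF q A rc] by (rule sum.cartesian_product[symmetric])
    finally show "A $$ (r, c) = ?S $$ (r, c)" ..
  qed
qed (auto simp: matrix_vs component_subspace module_mat_simps clock_shift_coeff_add
    add_smult_distrib_right_mat[OF monomial_carrier], simp add: component_def, blast)

lemma one_object_matrix_simps:
  "Obj (one_object_kcat (module_mat TYPE('k) n n)) = {()}"
  "Hom (one_object_kcat (module_mat TYPE('k) n n)) u v = module_mat TYPE('k) n n"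
  "Comp (one_object_kcat (module_mat TYPE('k) n n)) u v w = (*)"
  "Ident (one_object_kcat (module_mat TYPE('k) n n)) u = 1\<^sub>m n"
  by (auto simp: one_object_kcat_def module_mat_simps)

lemma component_grading:
  "grading class_ring (one_object_kcat (module_mat TYPE('k) n n)) (C \<times>\<times> C) component"
proof (intro grading.intro grading_axioms.intro k_category_matrix_algebra DirProd_group is_group,
    unfold one_object_matrix_simps)
  fix u v w :: unit and s r and f g :: "'k mat"
  assume sr: "s \<in> carrier (C \<times>\<times> C)" "r \<in> carrier (C \<times>\<times> C)"
    and "f \<in> component s u v" "g \<in> component r v w"
  moreover obtain d where
    "\<And>a b. (a \<cdot>\<^sub>m monomial r) * (b \<cdot>\<^sub>m monomial s) = (a * b * d) \<cdot>\<^sub>m monomial (r \<otimes>\<^bsub>C \<times>\<times> C\<^esub> s)"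
    using smult_monomial_mult[OF sr(2,1)] by metis
  ultimately show "g * f \<in> component (r \<otimes>\<^bsub>C \<times>\<times> C\<^esub> s) u w"
    by (auto simp: component_def)
qed (rule component_decomposition)

text \<open>
  Each degree is attained by a walk consisting of a single monomial.
\<close>
lemma component_connected:
  "connected_grading class_ring (one_object_kcat (module_mat TYPE('k) n n)) (C \<times>\<times> C) component"
  unfolding connected_grading_def
proof (intro conjI component_grading ballI)
  let ?M = "one_object_kcat (module_mat TYPE('k) n n)"
  interpret grading class_ring ?M "C \<times>\<times> C" component by (rule component_grading)
  fix u v s assume s: "s \<in> carrier (C \<times>\<times> C)"
  let ?w = "[((), (), monomial s, 1)]"
  have mem: "monomial s \<in> component s () ()"
    unfolding component_def by (auto intro!: exI[of _ 1] simp: monomial_def clock_shift_def)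
  then have "mor_degree (C \<times>\<times> C) component () () (monomial s) = s"
    using s by (intro degree_eq) (auto simp: one_object_matrix_simps module_mat_simps monomial_nonzero)
  then have "walk_degree (C \<times>\<times> C) component ?w = s" using s by simp
  moreover have "nonzero_walk ?M u v ?w"
    by (simp add: nonzero_walk_def one_object_matrix_simps module_mat_simps monomial_nonzero)
  moreover have "homogeneous_walk (C \<times>\<times> C) component ?w"
    using s mem by (auto simp: homogeneous_walk_def)
  ultimately show "\<exists>ws. nonzero_walk ?M u v ws \<and> homogeneous_walk (C \<times>\<times> C) component ws \<and>
      walk_degree (C \<times>\<times> C) component ws = s"
    by blast
qed

lemma component_simply_connected:
  "simply_connected_grading TYPE('g) class_ring (one_object_kcat (module_mat TYPE('k) n n))
    (C \<times>\<times> C) component"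
  unfolding simply_connected_grading_def
proof (intro conjI component_connected)
  let ?M = "one_object_kcat (module_mat TYPE('k) n n)"
  interpret grading class_ring ?M "C \<times>\<times> C" component by (rule component_grading)
  show "simply_connected_kcat TYPE('g) class_ring (smash_product ?M (C \<times>\<times> C) component)"
  proof (rule simply_connected_smash_product; unfold one_object_matrix_simps module_mat_simps class_ring_simps)
    have one: "1\<^sub>m n = 1 \<cdot>\<^sub>m monomial (\<one>, \<one>)" by (simp add: monomial_one one_smult_mat)
    show "1\<^sub>m n \<in> component \<one>\<^bsub>C \<times>\<times> C\<^esub> u u" for u
      unfolding component_def one_DirProd using one by blast
    show "\<exists>e\<in>component s u v. e \<noteq> 0\<^sub>m n n \<and> (\<forall>f\<in>component s u v. \<exists>a\<in>UNIV. f = a \<cdot>\<^sub>m e)" for s u v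
    proof (intro bexI[of _ "monomial s"] conjI monomial_nonzero)
      show "monomial s \<in> component s u v"
        unfolding component_def by (auto intro!: exI[of _ 1] simp: monomial_def clock_shift_def)
    qed (auto simp: component_def)
    fix r s and u v w :: unit and f g :: "'k mat"
    assume rs: "r \<in> carrier (C \<times>\<times> C)" "s \<in> carrier (C \<times>\<times> C)"
      and f: "f \<in> component s u v" "f \<noteq> 0\<^sub>m n n" and g: "g \<in> component r v w" "g \<noteq> 0\<^sub>m n n"
    obtain b where b: "f = b \<cdot>\<^sub>m monomial s" "b \<noteq> 0"
      using f by (auto simp: component_def smult_monomial_eq_0_iff)
    obtain a where a: "g = a \<cdot>\<^sub>m monomial r" "a \<noteq> 0"
      using g by (auto simp: component_def smult_monomial_eq_0_iff)
    obtain d where "d \<noteq> 0" "g * f = (a * b * d) \<cdot>\<^sub>m monomial (r \<otimes>\<^bsub>C \<times>\<times> C\<^esub> s)"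
      using smult_monomial_mult[OF rs] a(1) b(1) by metis
    then show "g * f \<noteq> 0\<^sub>m n n" using a(2) b(2) by (simp add: smult_monomial_eq_0_iff)
  qed simp
qed

text \<open>
  The degrees of \<open>x\<close> and \<open>y\<close> force those of all products, hence of all monomials, so each line
  \<open>component s\<close> lies in \<open>X s\<close>. The axioms of a grading speak of products only; therefore all
  exponents are made positive by adding \<open>n\<close>, and the identity matrix arises as \<open>x\<^sup>n y\<^sup>n\<close> rather
  than as an empty product.
\<close>
lemma component_unique:
  assumes X: "grading class_ring (one_object_kcat (module_mat TYPE('k) n n)) (C \<times>\<times> C) X"
    and x: "clock_shift n q 1 0 \<in> X (t, \<one>) () ()" and y: "clock_shift n q 0 1 \<in> X (\<one>, t) () ()"
    and s: "s \<in> carrier (C \<times>\<times> C)"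
  shows "X s = component s"
proof (intro ext)
  let ?V = "module_mat TYPE('k) n n"
  fix u v :: unit
  interpret grading class_ring "one_object_kcat ?V" "C \<times>\<times> C" X by (rule X)
  have D: "direct_sum_decomposition class_ring ?V (carrier (C \<times>\<times> C)) (\<lambda>s. X s u v)"
    using decomposition[of u v] by (simp add: one_object_matrix_simps)
  have mult: "g * f \<in> X (r \<otimes>\<^bsub>C \<times>\<times> C\<^esub> s) () ()"
    if "s \<in> carrier (C \<times>\<times> C)" "r \<in> carrier (C \<times>\<times> C)" "f \<in> X s () ()" "g \<in> X r () ()" for s r f g
    using graded_Comp[of "()" "()" "()" s r f g] that by (simp add: one_object_matrix_simps)
  have x_pow: "clock_shift n q (Suc i) 0 \<in> X (t [^] Suc i, \<one>) () ()" for i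
  proof (induction i)
    case (Suc i)
    from mult[OF _ _ x Suc] show ?case
      using t by (simp add: clock_shift_mult[OF q] one_smult_mat)
  qed (use x t in simp)
  have y_pow: "clock_shift n q 0 (Suc j) \<in> X (\<one>, t [^] Suc j) () ()" for j
  proof (induction j)
    case (Suc j)
    from mult[OF _ _ y Suc] show ?case
      using t by (simp add: clock_shift_mult[OF q] one_smult_mat)
  qed (use y t in simp)
  have "component r u v \<subseteq> X r u v" if r: "r \<in> carrier (C \<times>\<times> C)" for r
  proof
    fix A assume "A \<in> component r u v"
    then obtain a where A: "A = a \<cdot>\<^sub>m monomial r" by (auto simp: component_def)
    obtain i j :: nat where ij: "r = (t [^] i, t [^] j)" by (rule degree_cases[OF r])
    obtain k l where kl: "i + n = Suc k" "j + n = Suc l"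
      using n_pos by (metis add_gr_0 gr0_implies_Suc)
    have r': "r = (t [^] Suc k, t [^] Suc l)"
      unfolding ij kl[symmetric] using pow_eq_iff by simp
    have "clock_shift n q (Suc k) 0 * clock_shift n q 0 (Suc l) \<in> X r () ()"
      using mult[OF _ _ y_pow[of l] x_pow[of k]] t r' by simp
    then have "monomial r \<in> X r () ()"
      unfolding r' monomial_pow by (simp add: clock_shift_mult[OF q] one_smult_mat)
    then show "A \<in> X r u v"
      using subspace_mem(3)[OF decomposition_subspace[OF D r], of a "monomial r"]
      by (simp add: A module_mat_simps class_ring_simps)
  qed
  then show "X s u v = component s u v"
    by (rule decomposition_eqI[OF matrix_vs component_decomposition D _ s])
qed

end

theorem theorem4p9:
  fixes n :: nat and q :: "'k::field" and C :: "'c monoid" and t :: 'c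
    and x y :: "'k mat"
  assumes "primitive_root_of_unity n q"
    and "group C" and "Coset.order C = n" and "t \<in> carrier C" and "generate C {t} = carrier C"
    and "shift_matrix n x" and "clock_matrix n q y"
  shows "let K = (class_ring :: 'k ring);
             M = one_object_kcat (module_mat TYPE('k) n n);
             \<Gamma> = C \<times>\<times> C;
             P = (\<lambda>X. grading K M \<Gamma> X \<and> x \<in> X (t, \<one>\<^bsub>C\<^esub>) () () \<and> y \<in> X (\<one>\<^bsub>C\<^esub>, t) () ())
         in \<exists>X. P X \<and> (\<forall>X'. P X' \<longrightarrow> (\<forall>s\<in>carrier \<Gamma>. X' s = X s)) \<and>
              connected_grading K M \<Gamma> X \<and>
              simply_connected_grading TYPE('g) K M \<Gamma> X"
proof -
  interpret group C by fact
  interpret cyclic_clock_shift C n q t by unfold_locales fact+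
  have x: "x = clock_shift n q 1 0" by (rule shift_matrix_eq[OF assms(1,6)])
  have y: "y = clock_shift n q 0 1" by (rule clock_matrix_eq[OF assms(7)])
  have "x = 1 \<cdot>\<^sub>m monomial (t, \<one>\<^bsub>C\<^esub>)" "y = 1 \<cdot>\<^sub>m monomial (\<one>\<^bsub>C\<^esub>, t)"
    using monomial_pow[of 1 0] monomial_pow[of 0 1] t x y by (simp_all add: one_smult_mat)
  then have "x \<in> component (t, \<one>\<^bsub>C\<^esub>) () ()" "y \<in> component (\<one>\<^bsub>C\<^esub>, t) () ()"
    unfolding component_def by blast+
  moreover have "X s = component s"
    if "grading class_ring (one_object_kcat (module_mat TYPE('k) n n)) (C \<times>\<times> C) X \<and>
        x \<in> X (t, \<one>\<^bsub>C\<^esub>) () () \<and> y \<in> X (\<one>\<^bsub>C\<^esub>, t) () ()"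
      and "s \<in> carrier (C \<times>\<times> C)" for X s
    using that unfolding x y by (intro component_unique) blast+
  ultimately show ?thesis
    unfolding Let_def
    by (intro exI[of _ component] conjI allI impI ballI component_grading component_connected
        component_simply_connected)
qed

end
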